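(* Consider a Boolean control network $x(t+1)=Lu(t)x(t)$, $y(t)=Hx(t)$ ($t=0,1,\dots$) with states $x(t)\in\Delta_N$, inputs $u(t)\in\Delta_M$, outputs $y(t)\in\Delta_Q$, where $L\in\mathcal{L}_{N\times(NM)}$ and $H\in\mathcal{L}_{Q\times N}$. Let $\mathcal{G}=(\mathcal{V},\mathcal{E},\mathcal{W},2^{\Delta_M})$ be its weighted pair graph and let $A_{\mathcal{V}}$ be the deterministic finite automaton over the alphabet $\Delta_M$ generated from $\mathcal{G}$ by the subset construction described in the context. Then the Boolean control network is not reconstructible if and only if $L(A_{\mathcal{V}})=(\Delta_M)^*$.
   Context: Notation. $\delta_n^i$ is the $i$-th column of the $n\times n$ identity matrix and $\Delta_n=\{\delta_n^1,\dots,\delta_n^n\}$. $\mathcal{L}_{n\times s}$ is the set of $n\times s$ matrices all of whose columns lie in $\Delta_n$ (logical matrices). $N,M,Q$ are positive integers (for a genuine Boolean network with $n$ state, $m$ input and $q$ output nodes, $N=2^n$, $M=2^m$, $Q=2^q$, but arbitrary positive integers are allowed). Products are semi-tensor products; concretely, for $u\in\Delta_M$, $x\in\Delta_N$, $Lux=L(u\otimes x)\in\Delta_N$ with $\otimes$ the Kronecker product, so $L\delta_M^j\delta_N^i$ is column $(j-1)N+i$ of $L$; $Hx$ is the usual matrix product. For a nonempty finite alphabet $\Sigma$, $\Sigma^p$ is the set of words of length $p$, $\Sigma^*$ is the set of all finite words including the empty word $\epsilon$; $\mathbb{N}$ includes $0$; $2^A$ is the power set of $A$. Trajectories. For $x_0\in\Delta_N$,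 $p\in\mathbb{N}$ and $U=u_0\dots u_{p-1}\in(\Delta_M)^p$, let $x_{i+1}=Lu_ix_i$ for $0\le i<p$ and $y_i=Hx_i$ for $0\le i\le p$. Put $L_{x_0}^p(U)=x_0x_1\dots x_p$, $(HL)_{x_0}^p(U)=y_0y_1\dots y_p$, and let $L_{x_0}^p(U)[i]=x_i$. Reconstructibility. The network is called reconstructible if there are $p\in\mathbb{N}$ and $U\in(\Delta_M)^p$ such that for all different $x_0,\bar x_0\in\Delta_N$, $L_{x_0}^p(U)[p]\ne L_{\bar x_0}^p(U)[p]$ implies $(HL)_{x_0}^p(U)\ne(HL)_{\bar x_0}^p(U)$. Weighted pair graph. The vertex set is $\mathcal{V}=\{\{x,x'\}\mid x,x'\in\Delta_N,\ x\ne x',\ Hx=Hx'\}$ (unordered pairs). For $\{x_1,x_1'\},\{x_2,x_2'\}\in\mathcal{V}$, the pair $(\{x_1,x_1'\},\{x_2,x_2'\})$ is in the edge set $\mathcal{E}\subset\mathcal{V}\times\mathcal{V}$ iff there exists $u\in\Delta_M$ such that ($Lux_1=x_2$ and $Lux_1'=x_2'$) or ($Lux_1=x_2'$ and $Lux_1'=x_2$); the weight $\mathcal{W}(e)\subset\Delta_M$ of such an edge $e$ is the set of all such $u$. Automaton $A_{\mathcal{V}}$. A deterministic finite automaton (DFA) is a tuple $(S,\Sigma,\sigma,s_0,F)$ with finite state set $S$, alphabet $\Sigma$, partial transition function $\sigma:S\times\Sigma\to S$, initial state $s_0\in S$ and final states $F\subset S$; $\sigma$ is extended to a partial function on $S\times\Sigma^*$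 in the usual way, with $\sigma(s,\epsilon)=s$. The recognized language $L(A)$ is the set of words $w\in\Sigma^*$ such that $\sigma(s_0,w)$ is defined and belongs to $F$. For $s\subset\mathcal{V}$ and $a\in\Delta_M$ let $s_a=\{v'\in\mathcal{V}\mid\text{there is }v\in s\text{ with }(v,v')\in\mathcal{E}\text{ and }a\in\mathcal{W}((v,v'))\}$. The DFA $A_{\mathcal{V}}=(S,\Delta_M,\sigma,\mathcal{V},S)$ has initial state $\mathcal{V}$; its state set $S$ is the smallest set of subsets of $\mathcal{V}$ that contains $\mathcal{V}$ and contains $s_a$ whenever $s\in S$, $a\in\Delta_M$ and $s_a\neq\emptyset$; all states are final; $\sigma(s,a)=s_a$ if $s_a\ne\emptyset$, and $\sigma$ is not defined at $(s,a)$ if $s_a=\emptyset$. *)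

theory Defs
  imports "Jordan_Normal_Form.Matrix"
begin

section \<open>Logical matrices and Boolean control networks\<close>

text \<open>Indices are 0-based: \<open>unit_vec n i\<close> is the mathematical vector with 1 in position \<open>i + 1\<close>.\<close>

definition Delta :: "nat \<Rightarrow> real vec set" where
  "Delta n = {unit_vec n i | i. i < n}"

definition logical_mats :: "nat \<Rightarrow> nat \<Rightarrow> real mat set" where
  "logical_mats n s = {A \<in> carrier_mat n s. \<forall>j<s. col A j \<in> Delta n}"

definition kron_vec :: "real vec \<Rightarrow> real vec \<Rightarrow> real vec" (infixr "\<otimes>\<^sub>v" 75) where
  "u \<otimes>\<^sub>v x = vec (dim_vec u * dim_vec x) (\<lambda>k. u $ (k div dim_vec x) * x $ (k mod dim_vec x))"

text \<open>One step of the network: the semi-tensor product \<open>L u x\<close> of \<open>L\<close> with two column vectors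
  is \<open>L (u \<otimes> x)\<close>; the lemma \<open>step_unit_vec\<close> below identifies it with a column of \<open>L\<close>.\<close>

definition step :: "real mat \<Rightarrow> real vec \<Rightarrow> real vec \<Rightarrow> real vec" where
  "step L u x = L *\<^sub>v (u \<otimes>\<^sub>v x)"

fun state_traj :: "real mat \<Rightarrow> real vec \<Rightarrow> real vec list \<Rightarrow> real vec list" where
  "state_traj L x [] = [x]"
| "state_traj L x (u # U) = x # state_traj L (step L u x) U"

definition output_traj :: "real mat \<Rightarrow> real mat \<Rightarrow> real vec \<Rightarrow> real vec list \<Rightarrow> real vec list" where
  "output_traj L H x U = map (\<lambda>z. H *\<^sub>v z) (state_traj L x U)"

definition words :: "nat \<Rightarrow> 'a set \<Rightarrow> 'a list set" where
  "words p \<Sigma> = {w \<in> lists \<Sigma>. length w = p}"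

definition reconstructible :: "nat \<Rightarrow> nat \<Rightarrow> real mat \<Rightarrow> real mat \<Rightarrow> bool" where
  "reconstructible N M L H \<longleftrightarrow>
    (\<exists>p. \<exists>U \<in> words p (Delta M). \<forall>x0 \<in> Delta N. \<forall>x0' \<in> Delta N. x0 \<noteq> x0' \<longrightarrow>
      state_traj L x0 U ! p \<noteq> state_traj L x0' U ! p \<longrightarrow>
      output_traj L H x0 U \<noteq> output_traj L H x0' U)"


section \<open>The weighted pair graph\<close>

text \<open>A weighted graph \<open>(V, E, W, 2\<^sup>\<Sigma>)\<close>; the values of \<open>weight\<close> matter only on edges.\<close>

record ('v, 'a) wgraph =
  verts :: "'v set"
  edges :: "('v \<times> 'v) set"
  weight :: "'v \<times> 'v \<Rightarrow> 'a set"
  weight_sets :: "'a set set"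

definition pair_verts :: "nat \<Rightarrow> real mat \<Rightarrow> real vec set set" where
  "pair_verts N H = {{x, x'} | x x'. x \<in> Delta N \<and> x' \<in> Delta N \<and> x \<noteq> x' \<and> H *\<^sub>v x = H *\<^sub>v x'}"

definition drives_pair :: "real mat \<Rightarrow> real vec \<Rightarrow> real vec set \<Rightarrow> real vec set \<Rightarrow> bool" where
  "drives_pair L u v1 v2 \<longleftrightarrow>
    (\<exists>x1 x1' x2 x2'. v1 = {x1, x1'} \<and> v2 = {x2, x2'} \<and>
      (step L u x1 = x2 \<and> step L u x1' = x2' \<or> step L u x1 = x2' \<and> step L u x1' = x2))"

definition pair_graph ::
    "nat \<Rightarrow> nat \<Rightarrow> real mat \<Rightarrow> real mat \<Rightarrow> (real vec set, real vec) wgraph" where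
  "pair_graph N M L H =
    \<lparr>verts = pair_verts N H,
     edges = {(v1, v2) \<in> pair_verts N H \<times> pair_verts N H. \<exists>u \<in> Delta M. drives_pair L u v1 v2},
     weight = (\<lambda>(v1, v2). {u \<in> Delta M. drives_pair L u v1 v2}),
     weight_sets = Pow (Delta M)\<rparr>"


section \<open>Deterministic finite automata with partial transition function\<close>

record ('s, 'a) dfa =
  states :: "'s set"
  alphabet :: "'a set"
  trans_fun :: "'s \<Rightarrow> 'a \<Rightarrow> 's option"
  init :: 's
  final :: "'s set"

definition is_dfa :: "('s, 'a) dfa \<Rightarrow> bool" where
  "is_dfa A \<longleftrightarrow>
    finite (states A) \<and> finite (alphabet A) \<and> alphabet A \<noteq> {} \<and>
    init A \<in> states A \<and> final A \<subseteq> states A \<and>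
    (\<forall>s a s'. trans_fun A s a = Some s' \<longrightarrow> s \<in> states A \<and> a \<in> alphabet A \<and> s' \<in> states A)"

fun run :: "('s, 'a) dfa \<Rightarrow> 's \<Rightarrow> 'a list \<Rightarrow> 's option" where
  "run A s [] = Some s"
| "run A s (a # w) = Option.bind (trans_fun A s a) (\<lambda>s'. run A s' w)"

definition lang :: "('s, 'a) dfa \<Rightarrow> 'a list set" where
  "lang A = {w \<in> lists (alphabet A). \<exists>s \<in> final A. run A (init A) w = Some s}"


section \<open>Subset construction\<close>

definition succ_set :: "('v, 'a) wgraph \<Rightarrow> 'v set \<Rightarrow> 'a \<Rightarrow> 'v set" where
  "succ_set G s a = {v' \<in> verts G. \<exists>v \<in> s. (v, v') \<in> edges G \<and> a \<in> weight G (v, v')}"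

inductive_set subset_states :: "('v, 'a) wgraph \<Rightarrow> 'a set \<Rightarrow> 'v set set"
  for G :: "('v, 'a) wgraph" and \<Sigma> :: "'a set" where
  init: "verts G \<in> subset_states G \<Sigma>"
| succ: "s \<in> subset_states G \<Sigma> \<Longrightarrow> a \<in> \<Sigma> \<Longrightarrow> succ_set G s a \<noteq> {} \<Longrightarrow>
    succ_set G s a \<in> subset_states G \<Sigma>"

definition subset_dfa :: "('v, 'a) wgraph \<Rightarrow> 'a set \<Rightarrow> ('v set, 'a) dfa" where
  "subset_dfa G \<Sigma> =
    \<lparr>states = subset_states G \<Sigma>,
     alphabet = \<Sigma>,
     trans_fun = (\<lambda>s a. if s \<in> subset_states G \<Sigma> \<and> a \<in> \<Sigma> \<and> succ_set G s a \<noteq> {}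
       then Some (succ_set G s a) else None),
     init = verts G,
     final = subset_states G \<Sigma>\<rparr>"


section \<open>Consistency of the encodings\<close>

lemma pair_index_less:
  fixes i j M N :: nat
  assumes "j < M" "i < N"
  shows "j * N + i < M * N"
proof -
  have "j * N + i < Suc j * N" using assms by simp
  also have "\<dots> \<le> M * N" using assms by (intro mult_right_mono) auto
  finally show ?thesis .
qed

lemma kron_unit_vec:
  assumes "j < M" "i < N"
  shows "unit_vec M j \<otimes>\<^sub>v unit_vec N i = unit_vec (M * N) (j * N + i)"
proof (rule eq_vecI)
  show "dim_vec (unit_vec M j \<otimes>\<^sub>v unit_vec N i) = dim_vec (unit_vec (M * N) (j * N + i) :: real vec)"
    by (simp add: kron_vec_def)
next
  fix k assume "k < dim_vec (unit_vec (M * N) (j * N + i) :: real vec)"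
  then have k: "k < M * N" by simp
  then have d: "k div N < M" by (simp add: less_mult_imp_div_less)
  have m: "k mod N < N" using assms by simp
  have "k = j * N + i \<longleftrightarrow> k div N = j \<and> k mod N = i"
    using assms div_mult_mod_eq[of k N] by auto
  moreover have "j * N + i < M * N"
    using assms by (blast intro: pair_index_less)
  ultimately show "(unit_vec M j \<otimes>\<^sub>v unit_vec N i) $ k = unit_vec (M * N) (j * N + i) $ k"
    using k d m assms by (auto simp: kron_vec_def unit_vec_def)
qed

lemma step_unit_vec:
  assumes "L \<in> carrier_mat N (N * M)" "j < M" "i < N"
  shows "step L (unit_vec M j) (unit_vec N i) = col L (j * N + i)"
proof -
  have "j * N + i < M * N"
    using assms by (blast intro: pair_index_less)
  then show ?thesis
    using assms unfolding step_def
    by (intro eq_vecI) (auto simp: kron_unit_vec mult.commute)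
qed

lemma finite_Delta: "finite (Delta n)"
  by (simp add: Delta_def)

lemma is_dfa_subset_dfa:
  assumes "finite (verts G)" "finite \<Sigma>" "\<Sigma> \<noteq> {}"
  shows "is_dfa (subset_dfa G \<Sigma>)"
proof -
  have "s \<subseteq> verts G" if "s \<in> subset_states G \<Sigma>" for s
    using that by cases (auto simp: succ_set_def)
  then have "finite (subset_states G \<Sigma>)"
    using assms(1) by (meson finite_Pow_iff finite_subset PowI subsetI)
  then show ?thesis
    using assms by (auto simp: is_dfa_def subset_dfa_def intro: subset_states.intros split: if_splits)
qed

lemma finite_pair_verts: "finite (pair_verts N H)"
  by (rule finite_subset[of _ "Pow (Delta N)"]) (auto simp: pair_verts_def finite_Delta)

lemma is_dfa_pair_graph:
  assumes "0 < M"
  shows "is_dfa (subset_dfa (pair_graph N M L H) (Delta M))"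
  using assms
  by (intro is_dfa_subset_dfa) (auto simp: pair_graph_def finite_pair_verts finite_Delta, auto simp: Delta_def)

end

theory Submission
  imports Defs
begin

text \<open>
  The network fails to be reconstructible when every input word \<open>U\<close> admits two initial states
  that produce the same outputs under \<open>U\<close> and yet end in different states.  The dynamics is
  deterministic, so two trajectories that once meet stay together; hence different end states mean
  different states at \<^emph>\<open>every\<close> time, and the two trajectories agree in output exactly when the
  unordered pair of current states is a vertex of the pair graph at every time
  (\<open>surviving_pair_iff\<close>).

  On the automaton side, an input \<open>a\<close> sends an unordered pair to its image under the map
  \<open>x \<mapsto> L a x\<close>, so each vertex has at most one \<open>a\<close>-successor, and the subset construction merely
  tracks all pairs at once, discarding those that leave the vertex set.  Thus a word can be read
  precisely if some pair survives along the whole word (\<open>subset_run_defined_iff\<close>).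

  The two descriptions match for every word, except that the empty word is accepted even if there
  are no vertices at all.  This exception is harmless: without vertices no word of length one is
  accepted, and the empty input word already witnesses reconstructibility.
\<close>

text \<open>An unordered pair is carried along as a set; each input acts on it by taking images.  A pair
  that collapses to a single state, or splits into different outputs, leaves \<open>pair_verts\<close>.\<close>

fun survives :: "nat \<Rightarrow> real mat \<Rightarrow> real mat \<Rightarrow> real vec set \<Rightarrow> real vec list \<Rightarrow> bool" where
  "survives N L H v [] \<longleftrightarrow> v \<in> pair_verts N H"
| "survives N L H v (u # U) \<longleftrightarrow> v \<in> pair_verts N H \<and> survives N L H (step L u ` v) U"

lemma survives_imp_vertex: "survives N L H v U \<Longrightarrow> v \<in> pair_verts N H"
  by (cases U) auto

lemma doubleton_in_pair_verts_iff:
  assumes "x \<in> Delta N" "x' \<in> Delta N"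
  shows "{x, x'} \<in> pair_verts N H \<longleftrightarrow> x \<noteq> x' \<and> H *\<^sub>v x = H *\<^sub>v x'"
  using assms by (auto simp: pair_verts_def doubleton_eq_iff)

lemma step_in_Delta:
  assumes L: "L \<in> logical_mats N (N * M)" and "u \<in> Delta M" "x \<in> Delta N"
  shows "step L u x \<in> Delta N"
proof -
  obtain j where j: "u = unit_vec M j" "j < M"
    using assms by (auto simp: Delta_def)
  obtain i where i: "x = unit_vec N i" "i < N"
    using assms by (auto simp: Delta_def)
  have "j * N + i < N * M"
    using pair_index_less[OF j(2) i(2)] by (simp add: mult.commute)
  then show ?thesis
    using L j i by (auto simp: step_unit_vec logical_mats_def)
qed

lemma output_traj_simps [simp]:
  "output_traj L H x [] = [H *\<^sub>v x]"
  "output_traj L H x (u # U) = (H *\<^sub>v x) # output_traj L H (step L u x) U"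
  by (simp_all add: output_traj_def)

text \<open>Determinism enters through the end states: if they differ, the states could not have been
  equal earlier, so equality of outputs is all that is left of being a vertex at each time.\<close>

lemma surviving_pair_iff:
  assumes "L \<in> logical_mats N (N * M)"
    and "x \<in> Delta N" "x' \<in> Delta N" "U \<in> lists (Delta M)"
  shows "survives N L H {x, x'} U \<longleftrightarrow>
    state_traj L x U ! length U \<noteq> state_traj L x' U ! length U \<and>
    output_traj L H x U = output_traj L H x' U"
  using assms(2-)
proof (induction U arbitrary: x x')
  case Nil
  then show ?case by (simp add: doubleton_in_pair_verts_iff)
next
  case (Cons u U)
  then have "step L u x \<in> Delta N" "step L u x' \<in> Delta N"
    using assms(1) by (auto intro: step_in_Delta)
  with Cons show ?case
    by (auto simp: doubleton_in_pair_verts_iff)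
qed

lemma surviving_pair_ex_iff:
  assumes "L \<in> logical_mats N (N * M)" "U \<in> lists (Delta M)"
  shows "(\<exists>v \<in> pair_verts N H. survives N L H v U) \<longleftrightarrow>
    (\<exists>x \<in> Delta N. \<exists>x' \<in> Delta N.
      state_traj L x U ! length U \<noteq> state_traj L x' U ! length U \<and>
      output_traj L H x U = output_traj L H x' U)" (is "?lhs \<longleftrightarrow> ?rhs")
proof
  assume ?lhs
  then obtain x x' where "x \<in> Delta N" "x' \<in> Delta N" "survives N L H {x, x'} U"
    by (auto simp: pair_verts_def)
  with assms show ?rhs
    by (meson surviving_pair_iff)
next
  assume ?rhs
  with assms show ?lhs
    by (meson surviving_pair_iff survives_imp_vertex)
qed

lemma not_reconstructible_iff:
  assumes "L \<in> logical_mats N (N * M)"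
  shows "\<not> reconstructible N M L H \<longleftrightarrow>
    (\<forall>U \<in> lists (Delta M). \<exists>v \<in> pair_verts N H. survives N L H v U)"
  using assms by (simp add: surviving_pair_ex_iff reconstructible_def words_def) metis

text \<open>The two orientations allowed in the definition of an edge are absorbed by the fact that
  vertices are unordered: both say that the target is the image of the source.\<close>

lemma drives_pair_iff_image:
  assumes "v \<in> pair_verts N H"
  shows "drives_pair L u v w \<longleftrightarrow> w = step L u ` v"
proof
  assume "drives_pair L u v w"
  then show "w = step L u ` v"
    by (auto simp: drives_pair_def)
next
  obtain x x' where "v = {x, x'}"
    using assms by (auto simp: pair_verts_def)
  moreover assume "w = step L u ` v"
  ultimately show "drives_pair L u v w"
    unfolding drives_pair_def by (metis image_insert image_empty)
qed

lemma succ_set_pair_graph: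
  assumes "s \<subseteq> pair_verts N H" "u \<in> Delta M"
  shows "succ_set (pair_graph N M L H) s u = (\<lambda>v. step L u ` v) ` s \<inter> pair_verts N H"
proof -
  have "succ_set (pair_graph N M L H) s u = {w \<in> pair_verts N H. \<exists>v \<in> s. drives_pair L u v w}"
    using assms by (auto simp: succ_set_def pair_graph_def)
  moreover have "drives_pair L u v w \<longleftrightarrow> w = step L u ` v" if "v \<in> s" for v w
    using assms(1) that by (intro drives_pair_iff_image) blast
  ultimately show ?thesis by auto
qed

lemma subset_states_subset_verts: "s \<in> subset_states G \<Sigma> \<Longrightarrow> s \<subseteq> verts G"
  by (erule subset_states.cases) (auto simp: succ_set_def)

lemma run_subset_dfa_in_states:
  "s \<in> subset_states G \<Sigma> \<Longrightarrow> run (subset_dfa G \<Sigma>) s w = Some t \<Longrightarrow> t \<in> subset_states G \<Sigma>"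
  by (induction w arbitrary: s)
    (auto simp: subset_dfa_def intro: subset_states.succ split: if_splits)

lemma lang_subset_dfa:
  "lang (subset_dfa G \<Sigma>) = {w \<in> lists \<Sigma>. run (subset_dfa G \<Sigma>) (verts G) w \<noteq> None}"
  using run_subset_dfa_in_states[OF subset_states.init]
  by (fastforce simp: lang_def subset_dfa_def)

text \<open>The state is required to be nonempty because the empty word can be read from any state,
  whereas it needs a vertex to survive.\<close>

lemma subset_run_defined_iff:
  assumes "s \<in> subset_states (pair_graph N M L H) (Delta M)" "s \<noteq> {}" "U \<in> lists (Delta M)"
  shows "run (subset_dfa (pair_graph N M L H) (Delta M)) s U \<noteq> None \<longleftrightarrow>
    (\<exists>v \<in> s. survives N L H v U)"
  using assms
proof (induction U arbitrary: s)
  case Nil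
  then have "s \<subseteq> pair_verts N H"
    using subset_states_subset_verts by (fastforce simp: pair_graph_def)
  with Nil show ?case by auto
next
  case (Cons u U)
  let ?G = "pair_graph N M L H"
  let ?A = "subset_dfa ?G (Delta M)"
  let ?t = "succ_set ?G s u"
  have u: "u \<in> Delta M" and U: "U \<in> lists (Delta M)"
    using Cons.prems by auto
  have sub: "s \<subseteq> pair_verts N H"
    using subset_states_subset_verts[OF Cons.prems(1)] by (simp add: pair_graph_def)
  have "(\<exists>v \<in> s. survives N L H v (u # U)) \<longleftrightarrow> (\<exists>v \<in> ?t. survives N L H v U)"
    using sub u by (auto simp: succ_set_pair_graph dest: survives_imp_vertex)
  moreover have "run ?A s (u # U) \<noteq> None \<longleftrightarrow> (\<exists>v \<in> ?t. survives N L H v U)"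
  proof (cases "?t = {}")
    case True
    then show ?thesis by (simp add: subset_dfa_def)
  next
    case False
    have "?t \<in> subset_states ?G (Delta M)"
      using Cons.prems(1) u False by (rule subset_states.succ)
    then have "run ?A ?t U \<noteq> None \<longleftrightarrow> (\<exists>v \<in> ?t. survives N L H v U)"
      using False U by (rule Cons.IH)
    moreover have "trans_fun ?A s u = Some ?t"
      using Cons.prems(1) u False by (simp add: subset_dfa_def)
    ultimately show ?thesis by simp
  qed
  ultimately show ?case by blast
qed

theorem theorem3p4:
  fixes N M Q :: nat and L H :: "real mat"
  assumes "N \<ge> 1" and "M \<ge> 1" and "Q \<ge> 1"
    and "L \<in> logical_mats N (N * M)"
    and "H \<in> logical_mats Q N"
  shows "\<not> reconstructible N M L H \<longleftrightarrow>
    lang (subset_dfa (pair_graph N M L H) (Delta M)) = lists (Delta M)"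
proof -
  let ?G = "pair_graph N M L H"
  let ?A = "subset_dfa ?G (Delta M)"
  have verts: "verts ?G = pair_verts N H"
    by (simp add: pair_graph_def)
  have lang_iff: "lang ?A = lists (Delta M) \<longleftrightarrow>
      (\<forall>U \<in> lists (Delta M). run ?A (pair_verts N H) U \<noteq> None)"
    by (auto simp: lang_subset_dfa verts)
  show ?thesis
  proof (cases "pair_verts N H = {}")
    case True
    \<comment> \<open>A word of length one is needed here: the empty word is accepted regardless.\<close>
    have u: "unit_vec M 0 \<in> Delta M" (is "?u \<in> _")
      using assms(2) by (auto simp: Delta_def)
    have "run ?A (pair_verts N H) [?u] = None"
      using True by (simp add: subset_dfa_def succ_set_def)
    then have "lang ?A \<noteq> lists (Delta M)"
      unfolding lang_iff using u by (intro notI) (auto dest!: bspec[of _ _ "[?u]"])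
    moreover have "reconstructible N M L H"
      using not_reconstructible_iff[OF assms(4)] True by blast
    ultimately show ?thesis by blast
  next
    case False
    have "pair_verts N H \<in> subset_states ?G (Delta M)"
      using subset_states.init[of ?G] by (simp add: verts)
    then show ?thesis
      unfolding lang_iff not_reconstructible_iff[OF assms(4)]
      using False by (simp add: subset_run_defined_iff del: not_None_eq)
  qed
qed

end
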